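(* $\mathcal{EN}\cap\mathscr{B}=\mathfrak{P}_2\cap\mathscr{B}$.
   Context: $2^\omega$ is the Cantor space, $[\omega]^\omega$ is the family of infinite subsets of $\omega$, and $\mathscr{B}$ is the class of all Borel subsets of $2^\omega$. For $S\in[\omega]^\omega$, $2^S$ carries the standard product probability measure (product of the uniform measures on $\{0,1\}$), and null in $2^S$ refers to this measure. For $X\subseteq 2^\omega$, $X\restriction S=\{x\restriction S:x\in X\}\subseteq 2^S$. Define $\mathcal{EN}=\{X\subseteq 2^\omega:(\forall S\in[\omega]^\omega)\ X\restriction S\text{ is null in }2^S\}$ and $\mathfrak{P}_2=\{X\subseteq 2^\omega:(\forall S\in[\omega]^\omega)\ X\restriction S\neq 2^S\}$. *)

theory Defs
  imports "HOL-Probability.Probability"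
begin

text \<open>
  The Cantor space is the type \<^typ>\<open>nat \<Rightarrow> bool\<close> with the product topology of the library
  (the topology on \<^typ>\<open>bool\<close> is discrete). For a set \<open>S\<close> of coordinates, \<open>2\<^sup>S\<close> is represented
  by the functions that are \<^term>\<open>undefined\<close> outside \<open>S\<close>, so that \<^const>\<open>restrict\<close> is
  restriction of functions and \<^const>\<open>PiM\<close> gives the product measure.
\<close>

definition cantor_on :: "nat set \<Rightarrow> (nat \<Rightarrow> bool) set" where
  "cantor_on S = S \<rightarrow>\<^sub>E UNIV"

definition cantor_measure :: "nat set \<Rightarrow> (nat \<Rightarrow> bool) measure" where
  "cantor_measure S = PiM S (\<lambda>_. uniform_count_measure UNIV)"

definition restrict_set :: "(nat \<Rightarrow> bool) set \<Rightarrow> nat set \<Rightarrow> (nat \<Rightarrow> bool) set" where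
  "restrict_set X S = (\<lambda>x. restrict x S) ` X"

text \<open>
  The projections \<open>restrict_set X S\<close> need not be measurable for \<open>PiM\<close>, even for Borel \<open>X\<close>, so
  being null refers to the completed measure: a set is null iff it is contained in a
  measurable set of measure zero.
\<close>

definition EN :: "(nat \<Rightarrow> bool) set set" where
  "EN = {X. \<forall>S. infinite S \<longrightarrow> restrict_set X S \<in> null_sets (completion (cantor_measure S))}"

definition P2 :: "(nat \<Rightarrow> bool) set set" where
  "P2 = {X. \<forall>S. infinite S \<longrightarrow> restrict_set X S \<noteq> cantor_on S}"

end

theory Submission
  imports Defs
begin

text \<open>
  If \<open>X\<close> realises every 0-1 pattern on some infinite \<open>S\<close>, its projection to \<open>S\<close> has measure one,
  so \<open>EN \<subseteq> P2\<close>. For the converse, let \<open>X\<close> be Borel and let its projection to \<open>S\<close> be non-null.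
  An infinite \<open>T \<subseteq> S\<close> is wanted such that every pattern on \<open>T\<close> is realised in \<open>X\<close>.

  Call a set small if its projection to \<open>S\<close> is null. The small sets form a \<open>\<sigma>\<close>-ideal, and for
  infinite \<open>B \<subseteq> S\<close> the set of points with a constant given value on \<open>B\<close> is small. The measure
  enters only through these facts. They imply that a set which is not small is split by all but
  finitely many coordinates \<open>t \<in> S\<close> into two parts that are not small (\<open>finite_unsplit\<close>). If \<open>X\<close>
  were compact, it would now be enough to choose coordinates \<open>t\<^sub>0, t\<^sub>1, \<dots>\<close> one by one, each
  splitting all the finitely many pieces determined by the earlier ones (\<open>rich_insert\<close>): every
  finite pattern is then realised, hence, by compactness, every pattern is.

  In general \<open>X\<close> is the projection of a closed set \<open>C\<close> in the product of the Cantor space and the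
  Baire space (\<open>borel_imp_analytic\<close>). As in the proof of Choquet's capacitability theorem, after
  each choice of a coordinate \<open>t\<^sub>n\<close> the \<open>n\<close>-th coordinate of the Baire space is bounded, with a
  bound so large that no piece becomes small (\<open>rich_bound\<close>). For every pattern on \<open>T\<close>, the points
  that realise its finite parts then lie in a compact set, and the closedness of \<open>C\<close> gives a
  point of \<open>C\<close> that realises all of it (\<open>analytic_not_small_realises_patterns\<close>). Interleaving the
  two choices avoids the measurability of analytic sets and the continuity of outer measures.
\<close>

section \<open>Borel sets are projections of closed sets\<close>

definition analytic :: "'a::topological_space set \<Rightarrow> bool" where
  "analytic A \<longleftrightarrow> (\<exists>C :: ('a \<times> (nat \<Rightarrow> nat)) set. closed C \<and> A = fst ` C)"

lemma closed_imp_analytic: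
  assumes "closed A"
  shows "analytic A"
  unfolding analytic_def
proof (intro exI conjI)
  show "closed (A \<times> (UNIV :: (nat \<Rightarrow> nat) set))"
    using assms by (simp add: closed_Times)
qed simp

lemma continuous_snd_coordinate:
  "continuous_on UNIV (\<lambda>p :: 'a::topological_space \<times> (nat \<Rightarrow> nat). snd p i)"
  by (rule continuous_on_product_then_coordinatewise) (intro continuous_intros)

text \<open>The first entry of the Baire witness records which of the sets is met, the others form a
  witness for that set.\<close>

lemma analytic_UN:
  fixes A :: "nat \<Rightarrow> 'a::topological_space set"
  assumes "\<And>n. analytic (A n)"
  shows "analytic (\<Union>n. A n)"
proof -
  obtain C :: "nat \<Rightarrow> ('a \<times> (nat \<Rightarrow> nat)) set"
    where cl: "\<And>n. closed (C n)" and A: "\<And>n. A n = fst ` C n"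
    using assms unfolding analytic_def by metis
  define D where "D = {p :: 'a \<times> (nat \<Rightarrow> nat). (fst p, \<lambda>k. snd p (Suc k)) \<in> C (snd p 0)}"
  have "continuous_on UNIV (\<lambda>p :: 'a \<times> (nat \<Rightarrow> nat). (fst p, \<lambda>k. snd p (Suc k)))"
    by (intro continuous_on_Pair continuous_intros continuous_on_coordinatewise_then_product
        continuous_snd_coordinate)
  then have 1: "closed {p :: 'a \<times> (nat \<Rightarrow> nat). (fst p, \<lambda>k. snd p (Suc k)) \<in> C m}" for m
    using closed_vimage[OF cl] by (simp add: vimage_def)
  have 2: "closed {p :: 'a \<times> (nat \<Rightarrow> nat). snd p 0 \<noteq> m}" for m
  proof -
    have "closed ((\<lambda>p :: 'a \<times> (nat \<Rightarrow> nat). snd p 0) -` (- {m}))"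
      by (intro closed_vimage continuous_snd_coordinate) (simp add: closed_def Topological_Spaces.open_discrete)
    then show ?thesis by (simp add: vimage_def)
  qed
  have "D = (\<Inter>m. {p. snd p 0 \<noteq> m} \<union> {p. (fst p, \<lambda>k. snd p (Suc k)) \<in> C m})"
    unfolding D_def by auto
  with 1 2 have "closed D"
    by (auto intro!: closed_INT closed_Un)
  moreover have "(\<Union>n. A n) = fst ` D"
  proof (intro equalityI subsetI)
    fix x assume "x \<in> (\<Union>n. A n)"
    then obtain n y where "(x, y) \<in> C n"
      unfolding A by auto
    then have "(x, case_nat n y) \<in> D"
      by (simp add: D_def)
    then show "x \<in> fst ` D" by force
  next
    fix x assume "x \<in> fst ` D"
    then show "x \<in> (\<Union>n. A n)"
      unfolding A D_def by force
  qed
  ultimately show ?thesis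
    unfolding analytic_def by blast
qed

text \<open>A single element of the Baire space codes a sequence of witnesses, one for each set.\<close>

lemma analytic_INT:
  fixes A :: "nat \<Rightarrow> 'a::topological_space set"
  assumes "\<And>n. analytic (A n)"
  shows "analytic (\<Inter>n. A n)"
proof -
  obtain C :: "nat \<Rightarrow> ('a \<times> (nat \<Rightarrow> nat)) set"
    where cl: "\<And>n. closed (C n)" and A: "\<And>n. A n = fst ` C n"
    using assms unfolding analytic_def by metis
  define D where
    "D = {p :: 'a \<times> (nat \<Rightarrow> nat). \<forall>n. (fst p, \<lambda>k. snd p (prod_encode (n, k))) \<in> C n}"
  have "continuous_on UNIV (\<lambda>p :: 'a \<times> (nat \<Rightarrow> nat). (fst p, \<lambda>k. snd p (prod_encode (n, k))))"
    for n
    by (intro continuous_on_Pair continuous_intros continuous_on_coordinatewise_then_product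
        continuous_snd_coordinate)
  from closed_vimage[OF cl this]
  have "closed {p :: 'a \<times> (nat \<Rightarrow> nat). (fst p, \<lambda>k. snd p (prod_encode (n, k))) \<in> C n}" for n
    by (simp add: vimage_def)
  then have "closed D"
    unfolding D_def by (intro closed_Collect_all)
  moreover have "(\<Inter>n. A n) = fst ` D"
  proof (intro equalityI subsetI)
    fix x assume "x \<in> (\<Inter>n. A n)"
    then have "\<forall>n. \<exists>y. (x, y) \<in> C n"
      unfolding A by fastforce
    then obtain y where "\<And>n. (x, y n) \<in> C n" by metis
    then have "(x, \<lambda>k. case prod_decode k of (n, i) \<Rightarrow> y n i) \<in> D"
      by (simp add: D_def)
    then show "x \<in> fst ` D" by force
  next
    fix x assume "x \<in> fst ` D"
    then show "x \<in> (\<Inter>n. A n)"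
      unfolding A D_def by force
  qed
  ultimately show ?thesis
    unfolding analytic_def by blast
qed

text \<open>This makes the Borel sets of the Cantor space the product \<open>\<sigma>\<close>-algebra.\<close>

instance bool :: second_countable_topology
proof
  have "(open :: bool set \<Rightarrow> bool) = generate_topology UNIV"
    by (intro ext) (simp add: Topological_Spaces.open_discrete generate_topology.Basis)
  then show "\<exists>B :: bool set set. countable B \<and> open = generate_topology B"
    by (intro exI[of _ UNIV]) (simp add: countable_finite)
qed

text \<open>The analytic sets are not closed under complements, so the induction over the Borel sets
  carries the complement along. It starts from the clopen subbasic sets.\<close>

lemma borel_imp_analytic:
  fixes A :: "(nat \<Rightarrow> bool) set"
  assumes "A \<in> sets borel"
  shows "analytic A"
proof -
  let ?G = "{{f \<in> UNIV \<rightarrow>\<^sub>E space borel. f i \<in> B} |i B. i \<in> (UNIV :: nat set) \<and> B \<in> sets (borel :: bool measure)}"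
  have "A \<in> sets (Pi\<^sub>M UNIV (\<lambda>_ :: nat. borel :: bool measure))"
    using assms unfolding sets_PiM_equal_borel .
  then have "A \<in> sigma_sets UNIV ?G"
    by (simp add: sets_PiM_single)
  then have "analytic A \<and> analytic (- A)"
  proof induction
    case (Basic a)
    then obtain i B where a: "a = (\<lambda>f :: nat \<Rightarrow> bool. f i) -` B"
      by auto
    have "closed ((\<lambda>f :: nat \<Rightarrow> bool. f i) -` E)" for E
      by (intro closed_vimage continuous_on_product_coordinates) (simp add: closed_def Topological_Spaces.open_discrete)
    from this[of B] this[of "- B"] show ?case
      unfolding a by (auto intro!: closed_imp_analytic simp: vimage_Compl)
  next
    case Empty
    then show ?case by (auto intro: closed_imp_analytic)
  next
    case (Compl a)
    then show ?case
      unfolding Compl_eq_Diff_UNIV[symmetric] double_compl by (simp only: simp_thms)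
  next
    case (Union a)
    then have "analytic (\<Union>n. a n)" and "analytic (\<Inter>n. - a n)"
      by (simp_all add: analytic_UN analytic_INT)
    then show ?case
      by (simp only: uminus_SUP simp_thms)
  qed
  then show ?thesis ..
qed

section \<open>Analytic sets outside an ideal realise all patterns\<close>

locale coordinate_ideal =
  fixes small :: "(nat \<Rightarrow> bool) set \<Rightarrow> bool" and S :: "nat set"
  assumes infinite_S: "infinite S"
    and small_mono: "\<And>A B. small B \<Longrightarrow> A \<subseteq> B \<Longrightarrow> small A"
    and small_UN: "\<And>A :: nat \<Rightarrow> _. (\<And>n. small (A n)) \<Longrightarrow> small (\<Union>n. A n)"
    and small_constant: "\<And>B b. B \<subseteq> S \<Longrightarrow> infinite B \<Longrightarrow> small {x. \<forall>t\<in>B. x t = b}"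
begin

lemma small_UN_subset:
  fixes B :: "nat set"
  assumes "\<And>n. n \<in> B \<Longrightarrow> small (A n)"
  shows "small (\<Union>n\<in>B. A n)"
proof -
  have "small {}"
    using small_mono[OF small_constant[OF order.refl infinite_S]] by blast
  with assms have "small (\<Union>n. if n \<in> B then A n else {})"
    by (intro small_UN) auto
  then show ?thesis
    by (rule small_mono) auto
qed

lemma small_Un:
  assumes "small A" and "small B"
  shows "small (A \<union> B)"
proof (rule small_mono)
  show "small (\<Union>n :: nat. if n = 0 then A else B)"
    using assms by (intro small_UN) simp
qed auto

text \<open>If infinitely many coordinates \<open>t\<close> left only a small part of \<open>A\<close> with value \<open>b\<close> at \<open>t\<close>,
  then up to a small set \<open>A\<close> would be constant on all these coordinates, hence small.\<close>

lemma finite_unsplit: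
  assumes "\<not> small A"
  shows "finite {t \<in> S. small {x \<in> A. x t = b}}" (is "finite ?B")
proof (rule ccontr)
  assume "infinite ?B"
  then have "small {x. \<forall>t\<in>?B. x t = (\<not> b)}"
    by (intro small_constant) auto
  moreover have "small (\<Union>t\<in>?B. {x \<in> A. x t = b})"
    by (rule small_UN_subset) simp
  ultimately have "small ({x. \<forall>t\<in>?B. x t = (\<not> b)} \<union> (\<Union>t\<in>?B. {x \<in> A. x t = b}))"
    by (rule small_Un)
  moreover have "A \<subseteq> {x. \<forall>t\<in>?B. x t = (\<not> b)} \<union> (\<Union>t\<in>?B. {x \<in> A. x t = b})"
    by auto
  ultimately show False
    using assms small_mono by blast
qed

text \<open>A pattern on \<open>U\<close> is given as the set \<open>V\<close> of coordinates with value \<^term>\<open>True\<close>, so that a finite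
  \<open>U\<close> has only finitely many patterns.\<close>

definition piece :: "((nat \<Rightarrow> bool) \<times> (nat \<Rightarrow> nat)) set \<Rightarrow> nat set \<Rightarrow> nat set \<Rightarrow> (nat \<Rightarrow> bool) set" where
  "piece G U V = {x \<in> fst ` G. \<forall>t\<in>U. x t = (t \<in> V)}"

lemma piece_mono: "G \<subseteq> G' \<Longrightarrow> piece G U V \<subseteq> piece G' U V"
  unfolding piece_def by blast

definition rich :: "nat set \<Rightarrow> ((nat \<Rightarrow> bool) \<times> (nat \<Rightarrow> nat)) set \<Rightarrow> bool" where
  "rich U G \<longleftrightarrow> (\<forall>V\<subseteq>U. \<not> small (piece G U V))"

text \<open>Each of the finitely many pieces excludes only finitely many coordinates of \<open>S\<close>.\<close>

lemma rich_insert: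
  assumes "finite U" and "rich U G"
  obtains t where "t \<in> S - U" and "rich (insert t U) G"
proof -
  define Bad where "Bad = (\<Union>V\<in>Pow U. \<Union>b. {t \<in> S. small {x \<in> piece G U V. x t = b}})"
  have "finite Bad"
    unfolding Bad_def
    using assms by (intro finite_UN_I finite_unsplit) (auto simp: rich_def)
  then have "infinite (S - (U \<union> Bad))"
    using infinite_S assms(1) by (intro Diff_infinite_finite) auto
  then obtain t where t: "t \<in> S" "t \<notin> U" "t \<notin> Bad"
    by (metis DiffE Un_iff ex_in_conv finite.emptyI)
  have "rich (insert t U) G"
    unfolding rich_def
  proof (intro allI impI)
    fix V assume "V \<subseteq> insert t U"
    have "piece G (insert t U) V = {x \<in> piece G U (V \<inter> U). x t = (t \<in> V)}"
      unfolding piece_def by auto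
    moreover have "\<not> small {x \<in> piece G U (V \<inter> U). x t = (t \<in> V)}"
      using t unfolding Bad_def by blast
    ultimately show "\<not> small (piece G (insert t U) V)" by simp
  qed
  with t that show ?thesis by blast
qed

text \<open>Each piece is the countable union of its parts with a bounded \<open>n\<close>-th witness coordinate,
  so one of these parts is not small. As there are finitely many pieces, one bound serves all.\<close>

lemma rich_bound:
  assumes "finite U" and "rich U G"
  obtains m where "rich U {p \<in> G. snd p n \<le> m}"
proof -
  have "\<exists>m. \<not> small (piece {p \<in> G. snd p n \<le> m} U V)" if "V \<subseteq> U" for V
  proof (rule ccontr)
    assume "\<nexists>m. \<not> small (piece {p \<in> G. snd p n \<le> m} U V)"
    then have "small (\<Union>m. piece {p \<in> G. snd p n \<le> m} U V)"
      by (intro small_UN) auto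
    moreover have "piece G U V \<subseteq> (\<Union>m. piece {p \<in> G. snd p n \<le> m} U V)"
    proof
      fix x assume x: "x \<in> piece G U V"
      then obtain p where "p \<in> G" "x = fst p"
        unfolding piece_def by blast
      then have "x \<in> fst ` {q \<in> G. snd q n \<le> snd p n}"
        by simp
      with x have "x \<in> piece {q \<in> G. snd q n \<le> snd p n} U V"
        unfolding piece_def by simp
      then show "x \<in> (\<Union>m. piece {p \<in> G. snd p n \<le> m} U V)" by blast
    qed
    ultimately show False
      using assms that small_mono unfolding rich_def by blast
  qed
  then have "\<forall>V\<in>Pow U. \<exists>m. \<not> small (piece {p \<in> G. snd p n \<le> m} U V)"
    by blast
  from bchoice[OF this] obtain m
    where m: "\<And>V. V \<subseteq> U \<Longrightarrow> \<not> small (piece {p \<in> G. snd p n \<le> m V} U V)"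
    by blast
  have "rich U {p \<in> G. snd p n \<le> Max (m ` Pow U)}"
    unfolding rich_def
  proof (intro allI impI)
    fix V assume V: "V \<subseteq> U"
    then have "m V \<le> Max (m ` Pow U)"
      using assms(1) by (intro Max_ge) auto
    then have "piece {p \<in> G. snd p n \<le> m V} U V \<subseteq> piece {p \<in> G. snd p n \<le> Max (m ` Pow U)} U V"
      by (intro piece_mono) auto
    then show "\<not> small (piece {p \<in> G. snd p n \<le> Max (m ` Pow U)} U V)"
      using m[OF V] small_mono by blast
  qed
  with that show ?thesis by blast
qed

lemma compact_bounded_witnesses:
  "compact ((UNIV :: (nat \<Rightarrow> bool) set) \<times> {y :: nat \<Rightarrow> nat. \<forall>i. y i \<le> b i})"
proof (intro compact_Times)
  have "compactin (product_topology (\<lambda>_ :: nat. euclidean) UNIV) (UNIV \<rightarrow>\<^sub>E (UNIV :: bool set))"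
    unfolding compactin_PiE compactin_euclidean_iff by (simp add: finite_imp_compact)
  then show "compact (UNIV :: (nat \<Rightarrow> bool) set)"
    unfolding euclidean_product_topology compactin_euclidean_iff PiE_UNIV_domain by simp
  have "compactin (product_topology (\<lambda>_. euclidean) UNIV) (\<Pi>\<^sub>E i\<in>UNIV. {..b i})"
    unfolding compactin_PiE compactin_euclidean_iff by (simp add: finite_imp_compact)
  moreover have "(\<Pi>\<^sub>E i\<in>UNIV. {..b i}) = {y :: nat \<Rightarrow> nat. \<forall>i. y i \<le> b i}"
    by auto
  ultimately show "compact {y :: nat \<Rightarrow> nat. \<forall>i. y i \<le> b i}"
    unfolding euclidean_product_topology compactin_euclidean_iff by simp
qed

theorem analytic_not_small_realises_patterns:
  assumes "analytic A" and "\<not> small A"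
  obtains T where "T \<subseteq> S" and "infinite T" and "\<And>\<sigma>. \<exists>x\<in>A. \<forall>t\<in>T. x t = \<sigma> t"
proof -
  obtain C :: "((nat \<Rightarrow> bool) \<times> (nat \<Rightarrow> nat)) set" where C: "closed C" "A = fst ` C"
    using assms(1) unfolding analytic_def by blast
  define P where "P n s \<longleftrightarrow> (case s of (U, G) \<Rightarrow>
      finite U \<and> U \<subseteq> S \<and> card U = n \<and> rich U G \<and> G \<subseteq> C)" for n :: nat and s
  define Q where "Q n s s' \<longleftrightarrow> (case s of (U, G) \<Rightarrow> case s' of (U', G') \<Rightarrow>
      U \<subseteq> U' \<and> G' \<subseteq> G \<and> (\<exists>m. \<forall>p\<in>G'. snd p n \<le> m))"
    for n :: nat and s s' :: "nat set \<times> ((nat \<Rightarrow> bool) \<times> (nat \<Rightarrow> nat)) set"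
  have "\<exists>f. \<forall>n. P n (f n) \<and> Q n (f n) (f (Suc n))"
  proof (rule dependent_nat_choice)
    have "P 0 ({}, C)"
      using assms(2) C(2) by (simp add: P_def rich_def piece_def)
    then show "\<exists>s. P 0 s" ..
  next
    fix s n assume "P n s"
    then obtain U G where s: "s = (U, G)" and U: "finite U" "U \<subseteq> S" "card U = n"
      and G: "rich U G" "G \<subseteq> C"
      by (auto simp: P_def)
    obtain t where t: "t \<in> S - U" "rich (insert t U) G"
      using rich_insert U(1) G(1) by blast
    obtain m where "rich (insert t U) {p \<in> G. snd p n \<le> m}"
      using rich_bound[of "insert t U" G n] U(1) t(2) by blast
    then have "P (Suc n) (insert t U, {p \<in> G. snd p n \<le> m}) \<and>
        Q n s (insert t U, {p \<in> G. snd p n \<le> m})"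
      using U G t(1) by (auto simp: P_def Q_def s)
    then show "\<exists>s'. P (Suc n) s' \<and> Q n s s'" ..
  qed
  then obtain f where f: "\<And>n. P n (f n)" "\<And>n. Q n (f n) (f (Suc n))"
    by blast
  define U where "U n = fst (f n)" for n
  define G where "G n = snd (f n)" for n
  have U: "finite (U n)" "U n \<subseteq> S" "card (U n) = n"
    and G: "rich (U n) (G n)" "G n \<subseteq> C" for n
    using f(1)[of n] by (auto simp: P_def U_def G_def split_beta)
  have step: "U n \<subseteq> U (Suc n)" "G (Suc n) \<subseteq> G n" "\<exists>m. \<forall>p\<in>G (Suc n). snd p n \<le> m" for n
    using f(2)[of n] by (auto simp: Q_def U_def G_def split_beta)
  have U_mono: "U m \<subseteq> U n" if "m \<le> n" for m n
    using step(1) that by (rule lift_Suc_mono_le)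
  have G_mono: "G n \<subseteq> G m" if "m \<le> n" for m n
    using step(2) that by (rule lift_Suc_antimono_le)
  define T where "T = (\<Union>n. U n)"
  have "infinite T"
  proof
    assume "finite T"
    then have "card (U (Suc (card T))) \<le> card T"
      by (intro card_mono) (auto simp: T_def)
    then show False by (simp add: U(3))
  qed
  moreover have "T \<subseteq> S"
    using U(2) by (auto simp: T_def)
  moreover have "\<exists>x\<in>A. \<forall>t\<in>T. x t = \<sigma> t" for \<sigma>
  proof -
    have "\<exists>p\<in>G n. \<forall>t\<in>U n. fst p t = \<sigma> t" for n
    proof -
      have "\<not> small (piece (G n) (U n) {t \<in> U n. \<sigma> t})"
        using G(1)[of n] by (simp add: rich_def)
      moreover have "small {}"
        using small_UN_subset[of "{}"] by simp
      ultimately obtain x where "x \<in> piece (G n) (U n) {t \<in> U n. \<sigma> t}"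
        by fastforce
      then show ?thesis
        by (auto simp: piece_def)
    qed
    then obtain p where p: "\<And>n. p n \<in> G n" "\<And>n t. t \<in> U n \<Longrightarrow> fst (p n) t = \<sigma> t"
      by metis
    \<comment> \<open>From stage \<open>i + 1\<close> on, the \<open>i\<close>-th witness coordinate is bounded by construction; the
        finitely many earlier stages only enlarge the bound.\<close>
    have "\<exists>b. \<forall>n. snd (p n) i \<le> b" for i
    proof -
      obtain m where m: "\<And>q. q \<in> G (Suc i) \<Longrightarrow> snd q i \<le> m"
        using step(3) by blast
      have "snd (p n) i \<le> max m (Max ((\<lambda>n. snd (p n) i) ` {..i}))" for n
      proof (cases "n \<le> i")
        case True
        then show ?thesis by (intro max.coboundedI2 Max_ge) auto
      next
        case False
        then have "p n \<in> G (Suc i)"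
          using p(1) G_mono[of "Suc i" n] by auto
        then show ?thesis by (simp add: m max.coboundedI1)
      qed
      then show ?thesis by blast
    qed
    then obtain b where b: "\<And>i n. snd (p n) i \<le> b i"
      by metis
    \<comment> \<open>The points \<open>p n\<close> need not converge, but they all lie in the compact set \<open>K\<close> and witness
        the finite intersection property of the closed sets \<open>D n\<close>.\<close>
    define K where "K = (UNIV :: (nat \<Rightarrow> bool) set) \<times> {y :: nat \<Rightarrow> nat. \<forall>i. y i \<le> b i}"
    define D where "D n = {q \<in> C. \<forall>t\<in>U n. fst q t = \<sigma> t}" for n
    have D_mono: "D n \<subseteq> D m" if "m \<le> n" for m n
      using U_mono[OF that] by (auto simp: D_def)
    have "K \<inter> \<Inter>(D ` UNIV) \<noteq> {}"
    proof (rule compact_imp_fip_image)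
      show "compact K"
        unfolding K_def by (rule compact_bounded_witnesses)
      fix n
      have "continuous_on UNIV (\<lambda>q :: (nat \<Rightarrow> bool) \<times> (nat \<Rightarrow> nat). fst q t)" for t
        by (rule continuous_on_product_then_coordinatewise) (intro continuous_intros)
      then have "closed {q :: (nat \<Rightarrow> bool) \<times> (nat \<Rightarrow> nat). fst q t = \<sigma> t}" for t
        by (intro closed_Collect_eq continuous_intros)
      moreover have "D n = C \<inter> (\<Inter>t\<in>U n. {q. fst q t = \<sigma> t})"
        by (auto simp: D_def)
      ultimately show "closed (D n)"
        using C(1) by (simp add: closed_Int closed_INT)
    next
      fix I' :: "nat set" assume "finite I'"
      then obtain N where "I' \<subseteq> {..N}"
        using finite_nat_iff_bounded_le by blast
      moreover have "p N \<in> K \<inter> D N"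
        using p G(2)[of N] b by (auto simp: K_def D_def mem_Times_iff)
      ultimately have "p N \<in> K \<inter> \<Inter>(D ` I')"
        using D_mono by blast
      then show "K \<inter> \<Inter>(D ` I') \<noteq> {}" by blast
    qed
    then obtain q where "\<And>n. q \<in> D n" by blast
    then have "q \<in> C" "\<forall>t\<in>T. fst q t = \<sigma> t"
      by (auto simp: D_def T_def)
    then show ?thesis
      using C(2) by blast
  qed
  ultimately show ?thesis
    using that by blast
qed

end

section \<open>Sets with a null projection\<close>

lemma product_prob_space_fair_bits: "product_prob_space (\<lambda>_ :: nat. uniform_count_measure (UNIV :: bool set))"
  by (intro product_prob_spaceI prob_space_uniform_count_measure) auto

lemma space_cantor_measure: "space (cantor_measure S) = cantor_on S"
  by (simp add: cantor_measure_def cantor_on_def space_PiM space_uniform_count_measure)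

text \<open>Fixing \<open>n\<close> of the coordinates in \<open>B\<close> already bounds the measure by \<open>2\<^sup>-\<^sup>n\<close>.\<close>

lemma null_sets_constant_coordinates:
  assumes "B \<subseteq> S" and "infinite B"
  shows "{x \<in> space (cantor_measure S). \<forall>t\<in>B. x t = b} \<in> null_sets (cantor_measure S)" (is "?N \<in> _")
proof -
  let ?M = "cantor_measure S"
  have meas: "{x \<in> space ?M. \<forall>t\<in>J. x t = b} \<in> sets ?M" if "J \<subseteq> S" for J
  proof -
    have "(\<lambda>x. x t) \<in> measurable ?M (uniform_count_measure UNIV)" if "t \<in> J" for t
      using \<open>J \<subseteq> S\<close> that unfolding cantor_measure_def by (intro measurable_component_singleton) auto
    then have "{x \<in> space ?M. x t = b} \<in> sets ?M" if "t \<in> J" for t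
      using measurable_sets[of "\<lambda>x. x t" ?M "uniform_count_measure UNIV" "{b}"] that
      by (simp add: vimage_def Int_def conj_commute sets_uniform_count_measure)
    then have "{x \<in> space ?M. t \<in> J \<longrightarrow> x t = b} \<in> sets ?M" for t
      by (cases "t \<in> J") auto
    then have "{x \<in> space ?M. \<forall>t. t \<in> J \<longrightarrow> x t = b} \<in> sets ?M"
      by (rule sets.sets_Collect_countable_All)
    then show ?thesis
      by (simp add: Ball_def)
  qed
  have "emeasure ?M ?N \<le> ennreal ((1/2) ^ n)" for n
  proof -
    obtain J where J: "J \<subseteq> B" "finite J" "card J = n"
      using infinite_arbitrarily_large[OF assms(2)] by blast
    have "emeasure ?M ?N \<le> emeasure ?M {x \<in> space ?M. \<forall>t\<in>J. x t \<in> {b}}"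
      using J(1) assms(1) meas[of J] by (intro emeasure_mono) auto
    also have "\<dots> = (\<Prod>t\<in>J. emeasure (uniform_count_measure UNIV) {b})"
      unfolding cantor_measure_def using J assms(1)
      by (intro product_prob_space.emeasure_PiM_Collect[OF product_prob_space_fair_bits])
        (auto simp: sets_uniform_count_measure)
    also have "\<dots> = ennreal ((1/2) ^ n)"
    proof -
      have "emeasure (uniform_count_measure UNIV) {b} = ennreal (1/2)"
        by (simp add: emeasure_uniform_count_measure)
      then show ?thesis
        by (simp only: prod_constant J(3) ennreal_power)
    qed
    finally show ?thesis .
  qed
  moreover have "(\<lambda>n. ennreal ((1/2) ^ n)) \<longlonglongrightarrow> ennreal 0"
    by (intro tendsto_ennrealI LIMSEQ_power_zero) simp
  ultimately have "emeasure ?M ?N \<le> ennreal 0"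
    by (intro LIMSEQ_le_const) auto
  then show ?thesis
    using meas[OF assms(1)] by (intro null_setsI) auto
qed

lemma coordinate_ideal_null_projection:
  assumes "infinite S"
  shows "coordinate_ideal (\<lambda>A. restrict_set A S \<in> null_sets (completion (cantor_measure S))) S"
proof
  show "infinite S" by fact
next
  fix A B :: "(nat \<Rightarrow> bool) set"
  assume "restrict_set B S \<in> null_sets (completion (cantor_measure S))" "A \<subseteq> B"
  then show "restrict_set A S \<in> null_sets (completion (cantor_measure S))"
    by (elim null_sets_completion_subset[rotated]) (auto simp: restrict_set_def)
next
  fix A :: "nat \<Rightarrow> (nat \<Rightarrow> bool) set"
  assume "\<And>n. restrict_set (A n) S \<in> null_sets (completion (cantor_measure S))"
  then show "restrict_set (\<Union>n. A n) S \<in> null_sets (completion (cantor_measure S))"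
    by (simp add: restrict_set_def image_UN null_sets_UN)
next
  fix B b assume "B \<subseteq> S" "infinite B"
  then have "{x \<in> space (cantor_measure S). \<forall>t\<in>B. x t = b} \<in> null_sets (cantor_measure S)"
    by (rule null_sets_constant_coordinates)
  moreover have "restrict_set {x. \<forall>t\<in>B. x t = b} S \<subseteq> {x \<in> space (cantor_measure S). \<forall>t\<in>B. x t = b}"
    using \<open>B \<subseteq> S\<close> by (auto simp: restrict_set_def space_cantor_measure cantor_on_def)
  ultimately show "restrict_set {x. \<forall>t\<in>B. x t = b} S \<in> null_sets (completion (cantor_measure S))"
    unfolding null_sets_completion_iff2 by blast
qed

lemma EN_subset_P2: "EN \<subseteq> P2"
proof
  fix X assume X: "X \<in> EN"
  have "restrict_set X S \<noteq> cantor_on S" if "infinite S" for S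
  proof
    interpret prob_space "cantor_measure S"
      unfolding cantor_measure_def by (intro prob_space_PiM prob_space_uniform_count_measure) auto
    assume eq: "restrict_set X S = cantor_on S"
    have "restrict_set X S \<in> null_sets (completion (cantor_measure S))"
      using X that unfolding EN_def by blast
    then have "space (cantor_measure S) \<in> null_sets (completion (cantor_measure S))"
      unfolding eq space_cantor_measure .
    then show False
      by (simp add: null_sets_completion_iff null_sets_def emeasure_space_1)
  qed
  then show "X \<in> P2" by (simp add: P2_def)
qed

lemma borel_P2_imp_EN:
  assumes "X \<in> sets borel" and "X \<in> P2"
  shows "X \<in> EN"
proof (rule ccontr)
  assume "X \<notin> EN"
  then obtain S where S: "infinite S"
    "restrict_set X S \<notin> null_sets (completion (cantor_measure S))"
    by (auto simp: EN_def)
  interpret coordinate_ideal "\<lambda>A. restrict_set A S \<in> null_sets (completion (cantor_measure S))" S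
    using S(1) by (rule coordinate_ideal_null_projection)
  obtain T where T: "infinite T" "\<And>\<sigma>. \<exists>x\<in>X. \<forall>t\<in>T. x t = \<sigma> t"
    by (rule analytic_not_small_realises_patterns[OF borel_imp_analytic[OF assms(1)] S(2)]) (rule that)
  have "restrict_set X T = cantor_on T"
  proof (intro equalityI subsetI)
    fix \<sigma> assume \<sigma>: "\<sigma> \<in> cantor_on T"
    obtain x where x: "x \<in> X" "\<forall>t\<in>T. x t = \<sigma> t"
      using T(2) by blast
    have "restrict x T = \<sigma>"
    proof (rule extensionalityI)
      show "restrict x T \<in> extensional T" by simp
      show "\<sigma> \<in> extensional T"
        using \<sigma> by (simp add: cantor_on_def PiE_def)
    qed (use x(2) in simp)
    with x(1) show "\<sigma> \<in> restrict_set X T"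
      unfolding restrict_set_def by blast
  next
    fix z assume "z \<in> restrict_set X T"
    then show "z \<in> cantor_on T"
      by (auto simp: restrict_set_def cantor_on_def)
  qed
  with T(1) assms(2) show False by (simp add: P2_def)
qed

theorem theorem3p8: "EN \<inter> sets borel = P2 \<inter> sets borel"
  using EN_subset_P2 borel_P2_imp_EN by blast

end
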